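(* For any integer $\Delta>0$ and $\delta=2^{-\Delta}$, there exists a $\Delta$-regular graph $G$ such that $\lambda(\delta)\leq O(1)$, but the optimal value of SDP 1 (with parameter $\delta$) on $G$ is at least $\Omega(\Delta)$.
   Context: Graphs may be edge-weighted (weighted degree $\Delta$ for $\Delta$-regularity); for an edge $e=\{u,v\}$ with weight $w_e$ the Laplacian contribution is $L_e=w_e(\mathbf{e}_v-\mathbf{e}_u)(\mathbf{e}_v-\mathbf{e}_u)^\intercal$, and for arbitrary vertices $L_{u,v}=(\mathbf{e}_v-\mathbf{e}_u)(\mathbf{e}_v-\mathbf{e}_u)^\intercal$. $L_H=\sum_{e\in E(H)}L_e$, $\lambda_2$ is the second smallest eigenvalue, $G[S]$ the induced subgraph, and for $G$ with $n$ vertices $\lambda(\delta)=\max_{|S|\geq\delta n}\lambda_2(L_{G[S]})$. SDP 1 (parameter $\delta$): variables $\lambda$, $\mathbf{x}=(x_e)_{e\in E}$, $\mathbf{y}=(y_{\{u,v\}})_{u,v\in V}$; maximize $\lambda$ subject to (1) $\sum_{e}x_eL_e\succeq\lambda\sum_{u,v}y_{\{u,v\}}L_{u,v}$ ($\succeq$ is the positive semidefinite order); (2) $\sum_{v}y_{\{u,v\}}\geq\max_{e\ni u}x_e$ for all $u$; (3) $\delta n\,y_{\{u,v\}}\leq\sum_{w}y_{\{u,w\}}$ for all $u,v$; (4) $\mathbf{x},\mathbf{y}\geq0$, $\mathbf{x}\neq0$. $O(1)$ and $\Omega(\Delta)$ hide absolute constants. *)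

theory Defs
  imports
    "HOL-Library.Extended_Real"
    "HOL-Computational_Algebra.Polynomial"
    "Jordan_Normal_Form.Char_Poly"
begin

record wgraph =
  verts :: "nat set"
  edges :: "nat set set"
  weight :: "nat set \<Rightarrow> real"

definition wf_wgraph :: "wgraph \<Rightarrow> bool" where
  "wf_wgraph G \<longleftrightarrow> finite (verts G) \<and> verts G \<noteq> {} \<and>
     (\<forall>e\<in>edges G. e \<subseteq> verts G \<and> card e = 2 \<and> weight G e > 0)"

definition unweighted :: "wgraph \<Rightarrow> bool" where
  "unweighted G \<longleftrightarrow> (\<forall>e\<in>edges G. weight G e = 1)"

definition regular :: "wgraph \<Rightarrow> real \<Rightarrow> bool" where
  "regular G d \<longleftrightarrow> (\<forall>v\<in>verts G. (\<Sum>e | e \<in> edges G \<and> v \<in> e. weight G e) = d)"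

definition induced :: "wgraph \<Rightarrow> nat set \<Rightarrow> wgraph" where
  "induced G S = \<lparr>verts = S, edges = {e \<in> edges G. e \<subseteq> S}, weight = weight G\<rparr>"

definition std_vec :: "nat \<Rightarrow> nat \<Rightarrow> real" where
  "std_vec v a = (if a = v then 1 else 0)"

text \<open>Matrices indexed by a finite vertex set are functions of two vertices.\<close>

definition pair_lap :: "nat \<Rightarrow> nat \<Rightarrow> nat \<Rightarrow> nat \<Rightarrow> real" where
  "pair_lap u v a b = (std_vec v a - std_vec u a) * (std_vec v b - std_vec u b)"

text \<open>\<^term>\<open>pair_lap u v\<close> is symmetric in \<^term>\<open>u\<close> and \<^term>\<open>v\<close>, so for a two-element set
  \<^term>\<open>p\<close> the choice of the orientation \<^term>\<open>(Min p, Max p)\<close> is immaterial.\<close>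

definition set_lap :: "nat set \<Rightarrow> nat \<Rightarrow> nat \<Rightarrow> real" where
  "set_lap p = pair_lap (Min p) (Max p)"

definition edge_lap :: "wgraph \<Rightarrow> nat set \<Rightarrow> nat \<Rightarrow> nat \<Rightarrow> real" where
  "edge_lap G e a b = weight G e * set_lap e a b"

definition laplacian :: "wgraph \<Rightarrow> nat \<Rightarrow> nat \<Rightarrow> real" where
  "laplacian G a b = (\<Sum>e\<in>edges G. edge_lap G e a b)"

definition lap_mat :: "wgraph \<Rightarrow> real mat" where
  "lap_mat G = (let vs = sorted_list_of_set (verts G)
     in mat (card (verts G)) (card (verts G)) (\<lambda>(i, j). laplacian G (vs ! i) (vs ! j)))"

text \<open>The second smallest eigenvalue, eigenvalues being counted with multiplicity. It is meaningful
  for symmetric matrices of size at least 2.\<close>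

definition lambda2 :: "real mat \<Rightarrow> real" where
  "lambda2 A = sorted_list_of_multiset (proots (char_poly A)) ! 1"

text \<open>A one-vertex graph has no second eigenvalue, hence the restriction to \<^term>\<open>card S \<ge> 2\<close>;
  assigning the value 0 to one-vertex graphs gives the same maximum on graphs with at least two
  vertices (for \<^term>\<open>\<delta> \<le> 1\<close>), as Laplacian eigenvalues are nonnegative.\<close>

definition lambda_ind :: "wgraph \<Rightarrow> real \<Rightarrow> real" where
  "lambda_ind G \<delta> = Max {lambda2 (lap_mat (induced G S)) | S.
     S \<subseteq> verts G \<and> real (card S) \<ge> \<delta> * real (card (verts G)) \<and> card S \<ge> 2}"

definition psd_on :: "nat set \<Rightarrow> (nat \<Rightarrow> nat \<Rightarrow> real) \<Rightarrow> bool" where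
  "psd_on V M \<longleftrightarrow> (\<forall>a\<in>V. \<forall>b\<in>V. M a b = M b a) \<and>
     (\<forall>z::nat \<Rightarrow> real. 0 \<le> (\<Sum>a\<in>V. \<Sum>b\<in>V. z a * M a b * z b))"

definition vpairs :: "nat set \<Rightarrow> nat set set" where
  "vpairs V = {p. p \<subseteq> V \<and> card p = 2}"

text \<open>The variables \<^term>\<open>y\<close> are indexed by unordered pairs of distinct vertices. Admitting
  \<^term>\<open>u = v\<close> would degenerate the program, since \<^term>\<open>pair_lap u u\<close> vanishes.\<close>

definition sdp_feasible ::
  "wgraph \<Rightarrow> real \<Rightarrow> real \<Rightarrow> (nat set \<Rightarrow> real) \<Rightarrow> (nat set \<Rightarrow> real) \<Rightarrow> bool" where
  "sdp_feasible G \<delta> l x y \<longleftrightarrow>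
     psd_on (verts G) (\<lambda>a b. (\<Sum>e\<in>edges G. x e * edge_lap G e a b)
        - l * (\<Sum>p\<in>vpairs (verts G). y p * set_lap p a b)) \<and>
     (\<forall>u\<in>verts G. \<forall>e\<in>edges G. u \<in> e \<longrightarrow> (\<Sum>v\<in>verts G - {u}. y {u, v}) \<ge> x e) \<and>
     (\<forall>u\<in>verts G. \<forall>v\<in>verts G - {u}.
        \<delta> * real (card (verts G)) * y {u, v} \<le> (\<Sum>w\<in>verts G - {u}. y {u, w})) \<and>
     (\<forall>e\<in>edges G. x e \<ge> 0) \<and> (\<forall>p\<in>vpairs (verts G). y p \<ge> 0) \<and>
     (\<exists>e\<in>edges G. x e \<noteq> 0)"

text \<open>The value is an extended real, so that infeasible and unbounded programs get the values
  \<^term>\<open>-\<infinity>::ereal\<close> and \<^term>\<open>\<infinity>::ereal\<close>.\<close>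

definition sdp_value :: "wgraph \<Rightarrow> real \<Rightarrow> ereal" where
  "sdp_value G \<delta> = Sup {ereal l | l. \<exists>x y. sdp_feasible G \<delta> l x y}"

end

theory Submission
  imports Defs "Jordan_Normal_Form.Schur_Decomposition"
begin

text \<open>The graph is the hypercube of dimension \<open>\<Delta>\<close>, for which \<open>\<delta> n = 1\<close>. Every induced subgraph with
  at least two vertices is cut by some coordinate direction, and the cut edges form a matching, so
  that \<open>\<lambda>\<^sub>2 \<le> 2\<close>. Since \<open>\<delta> n = 1\<close> makes constraint (3) void, \<open>y\<close> may be concentrated on the edges
  themselves, which gives the value \<open>\<Delta>\<close>.\<close>

section \<open>Spectral theorem for real symmetric matrices\<close>

text \<open>The characteristic polynomial splits over the complex numbers. For an eigenvector
  \<open>v\<close> with eigenvalue \<open>a\<close>, symmetry lets the matrix move across the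
  Hermitian product, so \<open>a\<close> times the squared norm of \<open>v\<close> equals
  \<open>cnj a\<close> times it, and \<open>a\<close> is real.\<close>

lemma symmetric_real_char_poly_splits:
  fixes A :: "real mat"
  assumes A: "A \<in> carrier_mat n n" and sym: "transpose_mat A = A"
  obtains es where "char_poly A = (\<Prod>e\<leftarrow>es. [:- e, 1:])" "length es = n" "sorted es"
proof -
  let ?c = "complex_of_real"
  let ?A = "map_mat ?c A"
  have A': "?A \<in> carrier_mat n n" using A by simp
  obtain as where as: "char_poly ?A = (\<Prod>a\<leftarrow>as. [:- a, 1:])" and len: "length as = n"
    using char_poly_factorized[OF A'] by blast
  have real: "?c (Re a) = a" if "a \<in> set as" for a
  proof -
    have "poly (char_poly ?A) a = 0"
      using that unfolding as by (auto simp: poly_prod_list prod_list_zero_iff)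
    then obtain v where "eigenvector ?A v a"
      using eigenvalue_root_char_poly[OF A'] unfolding eigenvalue_def by blast
    then have v: "v \<in> carrier_vec n" and v0: "v \<noteq> 0\<^sub>v n" and ev: "?A *\<^sub>v v = a \<cdot>\<^sub>v v"
      using A' unfolding eigenvector_def by auto
    have "a * (v \<bullet>c v) = (?A *\<^sub>v v) \<bullet>c v"
      using v by (simp add: ev)
    also have "\<dots> = (\<Sum>i<n. \<Sum>j<n. ?c (A $$ (i, j)) * v $ j * cnj (v $ i))"
      using A v by (auto simp: scalar_prod_def sum_distrib_right atLeast0LessThan intro!: sum.cong)
    also have "\<dots> = (\<Sum>j<n. \<Sum>i<n. ?c (A $$ (i, j)) * v $ j * cnj (v $ i))"
      by (rule sum.swap)
    \<comment> \<open>Symmetry swaps the indices of the entry. As the entries are real, conjugation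
      leaves them alone, and the sum becomes the product with the matrix on the other side.\<close>
    also have "\<dots> = (\<Sum>j<n. \<Sum>i<n. ?c (A $$ (j, i)) * v $ j * cnj (v $ i))"
    proof (intro sum.cong refl)
      fix i j assume "i \<in> {..<n}" "j \<in> {..<n}"
      then show "?c (A $$ (i, j)) * v $ j * cnj (v $ i) = ?c (A $$ (j, i)) * v $ j * cnj (v $ i)"
        using arg_cong[OF sym, of "\<lambda>M. M $$ (i, j)"] A by simp
    qed
    also have "\<dots> = v \<bullet>c (?A *\<^sub>v v)"
      using A v by (auto simp: scalar_prod_def sum_distrib_left atLeast0LessThan intro!: sum.cong)
    also have "\<dots> = cnj a * (v \<bullet>c v)"
      using v by (simp add: ev conjugate_smult_vec)
    finally have "a = cnj a"
      using conjugate_square_eq_0_vec[OF v] v0 by auto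
    then show ?thesis by (simp add: complex_eq_iff)
  qed
  define es where "es = sort (map Re as)"
  interpret mp: map_poly_inj_comm_ring_hom ?c ..
  have "map_poly ?c (char_poly A) = (\<Prod>a\<leftarrow>as. [:- a, 1:])"
    using of_real_hom.char_poly_hom[OF A] as by metis
  also have "\<dots> = (\<Prod>a\<leftarrow>as. map_poly ?c [:- Re a, 1:])"
    using real by (intro arg_cong[of _ _ prod_list]) (auto simp: map_poly_pCons)
  also have "\<dots> = map_poly ?c (\<Prod>e\<leftarrow>map Re as. [:- e, 1:])"
    by (simp add: mp.hom_prod_list o_def del: mp.map_poly_pCons_hom)
  \<comment> \<open>Embedding real polynomials into complex ones is injective, so the identity
    descends.\<close>
  finally have "char_poly A = (\<Prod>e\<leftarrow>map Re as. [:- e, 1:])"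
    by simp
  also have "\<dots> = (\<Prod>e\<leftarrow>es. [:- e, 1:])"
    unfolding es_def prod_mset_prod_list[symmetric] mset_map mset_sort ..
  finally show thesis
    using len by (intro that[of es]) (auto simp: es_def)
qed

text \<open>Complete \<open>v\<close> to a basis, apply Gram-Schmidt, which keeps the first vector,
  and normalize. With an eigenvector for \<open>v\<close>, conjugation by \<open>W\<close> splits
  off its eigenvalue.\<close>

lemma orthogonal_mat_extending_vector:
  fixes v :: "real vec"
  assumes v: "v \<in> carrier_vec n" and v0: "v \<noteq> 0\<^sub>v n"
  obtains W where "W \<in> carrier_mat n n" "transpose_mat W * W = 1\<^sub>m n"
    "\<exists>c. col W 0 = c \<cdot>\<^sub>v v"
proof -
  interpret cof_vec_space n "TYPE(real)" .
  define b where "b = basis_completion v"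
  have b: "distinct b" "\<not> lin_dep (set b)" "set b \<subseteq> carrier_vec n" "hd b = v" "length b = n"
    using basis_completion[OF v v0] unfolding b_def by auto
  have n: "n \<noteq> 0" using v v0 by (auto simp: vec_eq_iff)
  then obtain vs where bv: "b = v # vs" using b by (cases b) auto
  define ws where "ws = gram_schmidt n b"
  have ws: "set ws \<subseteq> carrier_vec n" "corthogonal ws" "length ws = n"
    using gram_schmidt_result[OF b(3,1,2) ws_def] b(5) by auto
  have hdws: "ws ! 0 = v"
    using gram_schmidt_hd[OF v, of vs] ws(3) n by (cases ws) (auto simp: ws_def bv)
  have wsc: "ws ! i \<in> carrier_vec n" if "i < n" for i using ws that by auto
  \<comment> \<open>The case \<open>i = j\<close> says that no vector has norm 0, so that
    normalizing is possible.\<close>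
  have orth: "ws ! i \<bullet> ws ! j = 0 \<longleftrightarrow> i \<noteq> j" if "i < n" "j < n" for i j
    using corthogonalD[OF ws(2), of i j] that ws(3) by simp
  define us where "us = map (\<lambda>u. (1 / sqrt (u \<bullet> u)) \<cdot>\<^sub>v u) ws"
  define W where "W = mat_of_cols n us"
  have W: "W \<in> carrier_mat n n" using ws(3) by (simp add: W_def us_def mat_of_cols_def)
  have colW: "col W i = (1 / sqrt (ws ! i \<bullet> ws ! i)) \<cdot>\<^sub>v ws ! i" if "i < n" for i
    using that ws wsc by (simp add: W_def us_def)
  have "transpose_mat W * W = 1\<^sub>m n"
  proof (rule eq_matI)
    fix i j assume "i < dim_row (1\<^sub>m n :: real mat)" "j < dim_col (1\<^sub>m n :: real mat)"
    then have ij: "i < n" "j < n" by auto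
    have "(transpose_mat W * W) $$ (i, j) = col W i \<bullet> col W j"
      using W ij by simp
    also have "\<dots> = (if i = j then 1 else 0)"
    proof (cases "i = j")
      case True
      have "ws ! i \<bullet> ws ! i > 0"
        using orth[of i i] ij by (auto simp: less_le scalar_prod_def intro!: sum_nonneg)
      then show ?thesis using ij True wsc by (simp add: colW)
    qed (use ij wsc orth in \<open>simp add: colW smult_scalar_prod_distrib[of _ n] scalar_prod_smult_distrib[of _ n]\<close>)
    finally show "(transpose_mat W * W) $$ (i, j) = 1\<^sub>m n $$ (i, j)"
      using ij by simp
  qed (use W in auto)
  then show thesis
    using W colW[of 0] hdws n by (intro that[of W]) auto
qed

text \<open>Deflation, by induction on the list of roots: an orthogonal change of basis makes an
  eigenvector for the first root the first basis vector, and by symmetry the matrix splits into a 1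
  by 1 block and a smaller symmetric one. The diagonal follows the order of \<open>es\<close>, so a
  sorted list yields a sorted diagonal.\<close>

lemma symmetric_real_diagonalization:
  fixes A :: "real mat"
  assumes "A \<in> carrier_mat n n" "transpose_mat A = A"
    and "char_poly A = (\<Prod>e\<leftarrow>es. [:- e, 1:])"
  shows "\<exists>P\<in>carrier_mat n n. transpose_mat P * P = 1\<^sub>m n \<and>
    transpose_mat P * A * P = mat n n (\<lambda>(i, j). if i = j then es ! i else 0)"
  using assms
proof (induction es arbitrary: n A)
  case Nil
  then have "n = 0" using degree_monic_char_poly[of A n] by simp
  then show ?case using Nil.prems by (intro bexI[of _ "1\<^sub>m 0"]) auto
next
  case (Cons e es)
  note A = Cons.prems(1) and sym = Cons.prems(2)
  have cp: "char_poly A = [:- e, 1:] * (\<Prod>e\<leftarrow>es. [:- e, 1:])"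
    using Cons.prems(3) by simp
  then have "eigenvalue A e"
    by (simp add: eigenvalue_root_char_poly[OF A])
  then obtain v where v: "v \<in> carrier_vec n" "v \<noteq> 0\<^sub>v n" and ev: "A *\<^sub>v v = e \<cdot>\<^sub>v v"
    using A unfolding eigenvalue_def eigenvector_def by auto
  have "n \<noteq> 0" using v by (auto simp: vec_eq_iff)
  then obtain m where n: "n = Suc m" by (cases n) auto
  obtain W c where W: "W \<in> carrier_mat n n" and WW: "transpose_mat W * W = 1\<^sub>m n"
    and W0: "col W 0 = c \<cdot>\<^sub>v v"
    using orthogonal_mat_extending_vector[OF v] by metis
  have WW': "W * transpose_mat W = 1\<^sub>m n"
    using mat_mult_left_right_inverse[OF _ W WW] W by simp
  define A' where "A' = transpose_mat W * A * W"
  have A': "A' \<in> carrier_mat n n" using A W by (simp add: A'_def)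
  have symA': "transpose_mat A' = A'"
  proof -
    have "transpose_mat A' = transpose_mat W * transpose_mat (transpose_mat W * A)"
      unfolding A'_def using A W by (intro transpose_mult) auto
    also have "transpose_mat (transpose_mat W * A) = transpose_mat A * transpose_mat (transpose_mat W)"
      using A W by (intro transpose_mult) auto
    finally show ?thesis using A W by (simp add: A'_def sym)
  qed
  have symA'_index: "A' $$ (i, j) = A' $$ (j, i)" if "i < n" "j < n" for i j
    using arg_cong[OF symA', of "\<lambda>M. M $$ (i, j)"] that A' by simp
  \<comment> \<open>Column 0 of \<open>W\<close> is a multiple of the eigenvector, and the columns
    are orthonormal. Symmetry then clears the rest of row 0 as well.\<close>
  have col0: "A' $$ (i, 0) = (if i = 0 then e else 0)" if i: "i < n" for i
  proof -
    have "A' $$ (i, 0) = (transpose_mat W * (A * W)) $$ (i, 0)"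
      using A W by (simp add: A'_def)
    also have "\<dots> = col W i \<bullet> (A *\<^sub>v col W 0)"
      using A W i n by (simp add: mult_mat_vec_def)
    also have "A *\<^sub>v col W 0 = e \<cdot>\<^sub>v col W 0"
      using A v by (simp add: W0 mult_mat_vec ev smult_smult_assoc mult.commute)
    also have "col W i \<bullet> (e \<cdot>\<^sub>v col W 0) = e * (transpose_mat W * W) $$ (i, 0)"
      using W i n by simp
    finally show ?thesis using i n by (simp add: WW)
  qed
  define B where "B = mat m m (\<lambda>(i, j). A' $$ (Suc i, Suc j))"
  have B: "B \<in> carrier_mat m m" by (simp add: B_def)
  have symB: "transpose_mat B = B"
    using symA'_index by (intro eq_matI) (auto simp: B_def n)
  have blk: "A' = four_block_mat (mat 1 1 (\<lambda>_. e)) (0\<^sub>m 1 m) (0\<^sub>m m 1) B"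
  proof (rule eq_matI)
    fix i j assume "i < dim_row (four_block_mat (mat 1 1 (\<lambda>_. e)) (0\<^sub>m 1 m) (0\<^sub>m m 1) B)"
      "j < dim_col (four_block_mat (mat 1 1 (\<lambda>_. e)) (0\<^sub>m 1 m) (0\<^sub>m m 1) B)"
    then have ij: "i < n" "j < n" using B n by auto
    then show "A' $$ (i, j) = four_block_mat (mat 1 1 (\<lambda>_. e)) (0\<^sub>m 1 m) (0\<^sub>m m 1) B $$ (i, j)"
      using col0[of i] col0[of j] symA'_index[of i j] B n
      by (cases i; cases j) (auto simp: B_def)
  qed (use A' B n in auto)
  have "similar_mat_wit A' A (transpose_mat W) W"
    using A A' W WW WW' by (intro similar_mat_witI[of _ _ n]) (auto simp: A'_def)
  then have "char_poly A = char_poly A'"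
    using char_poly_similar unfolding similar_mat_def by metis
  also have "\<dots> = char_poly (mat 1 1 (\<lambda>_. e)) * char_poly B"
    unfolding blk by (rule char_poly_four_block_zeros_col) (use B in auto)
  also have "char_poly (mat 1 1 (\<lambda>_. e)) = [:- e, 1:]"
    by (simp add: char_poly_defs det_def sign_def)
  finally have "[:- e, 1:] * char_poly B = [:- e, 1:] * (\<Prod>e\<leftarrow>es. [:- e, 1:])"
    unfolding cp by simp
  \<comment> \<open>Cancelling the nonzero linear factor leaves exactly the remaining roots for
    \<open>B\<close>.\<close>
  then have "char_poly B = (\<Prod>e\<leftarrow>es. [:- e, 1:])"
    by (metis mult_cancel_left pCons_eq_0_iff zero_neq_one)
  from Cons.IH[OF B symB this] obtain Q where Q: "Q \<in> carrier_mat m m"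
    and QQ: "transpose_mat Q * Q = 1\<^sub>m m"
    and QB: "transpose_mat Q * B * Q = mat m m (\<lambda>(i, j). if i = j then es ! i else 0)"
    by blast
  \<comment> \<open>\<open>F\<close> fixes the split-off eigenvector and diagonalizes the other
    block; the required matrix is \<open>W * F\<close>.\<close>
  define F where "F = four_block_mat (1\<^sub>m 1) (0\<^sub>m 1 m) (0\<^sub>m m 1) Q"
  have F: "F \<in> carrier_mat n n" using Q n by (simp add: F_def four_block_carrier_mat[of _ 1 1 _ m m, simplified])
  have Ft: "transpose_mat F = four_block_mat (1\<^sub>m 1) (0\<^sub>m 1 m) (0\<^sub>m m 1) (transpose_mat Q)"
    unfolding F_def using Q by (subst transpose_four_block_mat[of _ 1 1 _ m _ m]) auto
  have FF: "transpose_mat F * F = 1\<^sub>m n"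
    unfolding Ft unfolding F_def using Q QQ n
    by (subst mult_four_block_mat[of _ 1 1 _ m _ m _ _ 1 _ m])
      (auto intro!: eq_matI)
  have FA: "transpose_mat F * A' * F = mat n n (\<lambda>(i, j). if i = j then (e # es) ! i else 0)"
  proof -
    have "transpose_mat F * A' * F =
      four_block_mat (mat 1 1 (\<lambda>_. e)) (0\<^sub>m 1 m) (0\<^sub>m m 1) (transpose_mat Q * B * Q)"
      unfolding Ft unfolding blk F_def using Q B
      by (simp add: mult_four_block_mat[of _ 1 1 _ m _ m _ _ 1 _ m])
    also have "\<dots> = mat n n (\<lambda>(i, j). if i = j then (e # es) ! i else 0)"
      unfolding QB n by (rule eq_matI) (auto simp: nth_Cons')
    finally show ?thesis .
  qed
  have Pt: "transpose_mat (W * F) = transpose_mat F * transpose_mat W"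
    using W F by (rule transpose_mult)
  have "transpose_mat (W * F) * (W * F) = transpose_mat F * ((transpose_mat W * W) * F)"
    unfolding Pt using W F by (simp add: assoc_mult_mat[of _ n n _ n _ n])
  also have "\<dots> = 1\<^sub>m n" using F FF by (simp add: WW)
  finally have 1: "transpose_mat (W * F) * (W * F) = 1\<^sub>m n" .
  have 2: "transpose_mat (W * F) * A * (W * F) = transpose_mat F * A' * F"
    unfolding Pt A'_def using W F A by (simp add: assoc_mult_mat[of _ n n _ n _ n])
  show ?case
    using 1 2 FA W F by (intro bexI[of _ "W * F"]) auto
qed

section \<open>Upper bounds on the second eigenvalue from test vectors\<close>

text \<open>The upper bound of Courant-Fischer: the plane spanned by \<open>u\<close> and
  \<open>v\<close> contains a nonzero vector orthogonal to an eigenvector of the least eigenvalue,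
  and on such a vector the Rayleigh quotient is at least the second eigenvalue.\<close>

lemma lambda2_le:
  fixes A :: "real mat"
  assumes A: "A \<in> carrier_mat n n" and sym: "transpose_mat A = A" and n: "2 \<le> n"
    and u: "u \<in> carrier_vec n" and v: "v \<in> carrier_vec n"
    and indep: "\<And>a b. a \<cdot>\<^sub>v u + b \<cdot>\<^sub>v v = 0\<^sub>v n \<Longrightarrow> a = 0 \<and> b = 0"
    and quad: "\<And>a b w. w = a \<cdot>\<^sub>v u + b \<cdot>\<^sub>v v \<Longrightarrow> w \<bullet> (A *\<^sub>v w) \<le> t * (w \<bullet> w)"
  shows "lambda2 A \<le> t"
proof -
  obtain es where es: "char_poly A = (\<Prod>e\<leftarrow>es. [:- e, 1:])" "length es = n" "sorted es"
    using symmetric_real_char_poly_splits[OF A sym] by blast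
  have "proots (\<Prod>e\<leftarrow>xs. [:- e, 1:]) = mset xs" for xs :: "real list"
  proof (induction xs)
    case (Cons a xs)
    have "(\<Prod>e\<leftarrow>xs. [:- e, 1:]) \<noteq> 0" by (auto simp: prod_list_zero_iff)
    then have "proots ([:- a, 1:] * (\<Prod>e\<leftarrow>xs. [:- e, 1:])) = {#a#} + mset xs"
      using Cons by (subst proots_mult) auto
    then show ?case by simp
  qed simp
  \<comment> \<open>The roots with multiplicity are the entries of the sorted list
    \<open>es\<close>; counting from 0, index 1 is the second smallest.\<close>
  then have l2: "lambda2 A = es ! 1"
    using es by (simp add: lambda2_def sorted_sort_id)
  obtain P where P: "P \<in> carrier_mat n n" and PP: "transpose_mat P * P = 1\<^sub>m n"
    and PA: "transpose_mat P * A * P = mat n n (\<lambda>(i, j). if i = j then es ! i else 0)"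
    using symmetric_real_diagonalization[OF A sym es(1)] by blast
  have PP': "P * transpose_mat P = 1\<^sub>m n"
    using mat_mult_left_right_inverse[OF _ P PP] P by simp
  \<comment> \<open>One homogeneous linear equation in two unknowns has a nontrivial
    solution.\<close>
  obtain a b where ab: "a \<noteq> 0 \<or> b \<noteq> 0" "a * (col P 0 \<bullet> u) + b * (col P 0 \<bullet> v) = 0"
  proof (cases "col P 0 \<bullet> u = 0")
    case True
    then show ?thesis using that[of 1 0] by simp
  next
    case False
    then show ?thesis using that[of "- (col P 0 \<bullet> v)" "col P 0 \<bullet> u"] by simp
  qed
  define w where "w = a \<cdot>\<^sub>v u + b \<cdot>\<^sub>v v"
  have w: "w \<in> carrier_vec n" using u v by (simp add: w_def)
  have w0: "w \<noteq> 0\<^sub>v n" using indep ab unfolding w_def by blast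
  \<comment> \<open>The coordinates of \<open>w\<close> in the orthonormal eigenbasis; by the choice
    of \<open>a\<close> and \<open>b\<close>, the coordinate at index 0 vanishes.\<close>
  define c where "c = transpose_mat P *\<^sub>v w"
  have c: "c \<in> carrier_vec n" using P w by (simp add: c_def)
  have c0: "c $ 0 = 0"
  proof -
    have "col P 0 \<in> carrier_vec n" using P n by auto
    then have "col P 0 \<bullet> w = 0"
      using u v ab(2)
      by (simp add: w_def scalar_prod_add_distrib[of _ n] scalar_prod_smult_distrib[of _ n])
    then show ?thesis using P n by (simp add: c_def)
  qed
  have wc: "w = P *\<^sub>v c"
    using P w PP' by (simp add: c_def assoc_mult_mat_vec[symmetric, of _ n n _ n])
  have "w \<bullet> w = c \<bullet> c"
    using transpose_vec_mult_scalar[OF P c w] by (simp flip: c_def wc)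
  also have "\<dots> = (\<Sum>i<n. (c $ i)\<^sup>2)"
    using c by (simp add: scalar_prod_def power2_eq_square atLeast0LessThan)
  finally have ww: "w \<bullet> w = (\<Sum>i<n. (c $ i)\<^sup>2)" .
  have "w \<bullet> (A *\<^sub>v w) = c \<bullet> (transpose_mat P *\<^sub>v (A *\<^sub>v w))"
    using transpose_vec_mult_scalar[of P n n c "A *\<^sub>v w"] P A c w wc
    by (metis comm_scalar_prod mult_mat_vec_carrier transpose_carrier_mat)
  also have "transpose_mat P *\<^sub>v (A *\<^sub>v w) = (transpose_mat P * A * P) *\<^sub>v c"
    unfolding wc using P A c by (simp add: assoc_mult_mat_vec[of _ n n _ n])
  also have "\<dots> = vec n (\<lambda>i. es ! i * c $ i)"
    unfolding PA using c
    by (intro eq_vecI) (auto simp: scalar_prod_def if_distrib[of "\<lambda>x. x * _"] cong: if_cong)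
  also have "c \<bullet> \<dots> = (\<Sum>i<n. es ! i * (c $ i)\<^sup>2)"
    using c by (auto simp: scalar_prod_def power2_eq_square atLeast0LessThan intro!: sum.cong)
  finally have wAw: "w \<bullet> (A *\<^sub>v w) = (\<Sum>i<n. es ! i * (c $ i)\<^sup>2)" .
  \<comment> \<open>Only \<open>es ! 0\<close> may lie below \<open>es ! 1\<close>, and its term has
    coefficient 0.\<close>
  have "es ! 1 * (w \<bullet> w) \<le> w \<bullet> (A *\<^sub>v w)"
    unfolding ww wAw sum_distrib_left
  proof (rule sum_mono)
    fix i assume i: "i \<in> {..<n}"
    show "es ! 1 * (c $ i)\<^sup>2 \<le> es ! i * (c $ i)\<^sup>2"
    proof (cases "i = 0")
      case False
      then have "es ! 1 \<le> es ! i" using es i by (intro sorted_nth_mono) auto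
      then show ?thesis by (intro mult_right_mono) auto
    qed (simp add: c0)
  qed
  also have "\<dots> \<le> t * (w \<bullet> w)" using quad[OF w_def] .
  finally have *: "es ! 1 * (w \<bullet> w) \<le> t * (w \<bullet> w)" .
  have "w \<bullet> w \<noteq> 0"
    using conjugate_square_eq_0_vec[OF w] w0 by simp
  moreover have "w \<bullet> w \<ge> 0" unfolding ww by (intro sum_nonneg) auto
  ultimately have "w \<bullet> w > 0" by simp
  then show ?thesis using * l2 by simp
qed

text \<open>The matrix is the outer product of a difference of standard vectors with itself, so its
  form is the square of a linear functional.\<close>

lemma set_lap_quadratic_form:
  assumes V: "finite V" and p: "p \<subseteq> V" "card p = 2"
  shows "(\<Sum>x\<in>V. \<Sum>y\<in>V. g x * set_lap p x y * g y) = (g (Max p) - g (Min p))\<^sup>2"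
proof -
  have "finite p" "p \<noteq> {}" using p by (auto intro: card_ge_0_finite)
  then have "Min p \<in> V" "Max p \<in> V" using p Min_in Max_in by blast+
  then have *: "(\<Sum>x\<in>V. g x * (std_vec (Max p) x - std_vec (Min p) x)) = g (Max p) - g (Min p)"
    using V by (simp add: std_vec_def right_diff_distrib sum_subtractf if_distrib[of "\<lambda>x. _ * x"] cong: if_cong)
  have "(\<Sum>x\<in>V. \<Sum>y\<in>V. g x * set_lap p x y * g y) =
    (\<Sum>x\<in>V. g x * (std_vec (Max p) x - std_vec (Min p) x)) *
    (\<Sum>y\<in>V. g y * (std_vec (Max p) y - std_vec (Min p) y))"
    unfolding sum_product by (simp add: set_lap_def pair_lap_def mult_ac)
  then show ?thesis by (simp add: * power2_eq_square)
qed

lemma laplacian_quadratic_form: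
  assumes wf: "wf_wgraph G"
  shows "(\<Sum>x\<in>verts G. \<Sum>y\<in>verts G. g x * laplacian G x y * g y) =
    (\<Sum>e\<in>edges G. weight G e * (g (Max e) - g (Min e))\<^sup>2)"
proof -
  let ?V = "verts G"
  have "(\<Sum>x\<in>?V. \<Sum>y\<in>?V. g x * laplacian G x y * g y) =
    (\<Sum>x\<in>?V. \<Sum>y\<in>?V. \<Sum>e\<in>edges G. weight G e * (g x * set_lap e x y * g y))"
    by (simp add: laplacian_def edge_lap_def sum_distrib_left sum_distrib_right mult_ac)
  also have "\<dots> = (\<Sum>x\<in>?V. \<Sum>e\<in>edges G. \<Sum>y\<in>?V. weight G e * (g x * set_lap e x y * g y))"
    by (intro sum.cong refl sum.swap)
  also have "\<dots> = (\<Sum>e\<in>edges G. \<Sum>x\<in>?V. \<Sum>y\<in>?V. weight G e * (g x * set_lap e x y * g y))"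
    by (rule sum.swap)
  also have "\<dots> = (\<Sum>e\<in>edges G. weight G e * (\<Sum>x\<in>?V. \<Sum>y\<in>?V. g x * set_lap e x y * g y))"
    by (simp add: sum_distrib_left)
  also have "\<dots> = (\<Sum>e\<in>edges G. weight G e * (g (Max e) - g (Min e))\<^sup>2)"
    using wf by (intro sum.cong refl) (auto simp: set_lap_quadratic_form wf_wgraph_def)
  finally show ?thesis .
qed

lemma sum_sorted_list_of_set_nth:
  assumes "finite V"
  shows "(\<Sum>i<card V. h (sorted_list_of_set V ! i)) = sum h V"
proof -
  have "bij_betw ((!) (sorted_list_of_set V)) {..<card V} V"
    using assms by (intro bij_betw_nth) auto
  then show ?thesis by (rule sum.reindex_bij_betw)
qed

text \<open>The test plane is spanned by \<open>f\<close> and the constants. Adding a constant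
  leaves the Laplacian form unchanged and, since \<open>f\<close> sums to 0, cannot decrease the
  norm; so a bound for \<open>f\<close> alone suffices.\<close>

lemma lambda2_lap_mat_le:
  assumes wf: "wf_wgraph G" and V2: "2 \<le> card (verts G)" and t: "0 \<le> t"
    and f0: "(\<Sum>x\<in>verts G. f x) = 0" and f: "\<exists>x\<in>verts G. f x \<noteq> 0"
    and bound: "(\<Sum>e\<in>edges G. weight G e * (f (Max e) - f (Min e))\<^sup>2) \<le> t * (\<Sum>x\<in>verts G. (f x)\<^sup>2)"
  shows "lambda2 (lap_mat G) \<le> t"
proof -
  let ?V = "verts G" and ?m = "card (verts G)" and ?L = "lap_mat G"
  let ?s = "\<lambda>i. sorted_list_of_set (verts G) ! i"
  have V: "finite ?V" using wf by (simp add: wf_wgraph_def)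
  have L: "?L = mat ?m ?m (\<lambda>(i, j). laplacian G (?s i) (?s j))"
    by (simp add: lap_mat_def Let_def)
  let ?u = "vec ?m (\<lambda>_. 1)" and ?v = "vec ?m (\<lambda>i. f (?s i))"
  have comb: "a \<cdot>\<^sub>v ?u + b \<cdot>\<^sub>v ?v = vec ?m (\<lambda>i. a + b * f (?s i))" for a b
    by (intro eq_vecI) auto
  \<comment> \<open>The cross term vanishes because \<open>f\<close> sums to 0.\<close>
  have sq: "(\<Sum>x\<in>?V. (a + b * f x)\<^sup>2) = a\<^sup>2 * ?m + b\<^sup>2 * (\<Sum>x\<in>?V. (f x)\<^sup>2)" for a b
  proof -
    have "(\<Sum>x\<in>?V. (a + b * f x)\<^sup>2) = (\<Sum>x\<in>?V. a\<^sup>2 + 2 * a * b * f x + b\<^sup>2 * (f x)\<^sup>2)"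
      by (simp add: power2_sum power_mult_distrib mult_ac add_ac)
    then show ?thesis by (simp add: sum.distrib f0 flip: sum_distrib_left)
  qed
  have f2: "0 < (\<Sum>x\<in>?V. (f x)\<^sup>2)"
  proof -
    obtain x where "x \<in> ?V" "f x \<noteq> 0" using f by blast
    then show ?thesis using V by (intro sum_pos2[of _ x]) auto
  qed
  show ?thesis
  proof (rule lambda2_le[of _ ?m ?u ?v])
    show "?L \<in> carrier_mat ?m ?m" by (simp add: L)
    show "transpose_mat ?L = ?L"
      unfolding L by (intro eq_matI) (auto simp: laplacian_def edge_lap_def set_lap_def pair_lap_def mult_ac)
  next
    fix a b assume "a \<cdot>\<^sub>v ?u + b \<cdot>\<^sub>v ?v = 0\<^sub>v ?m"
    then have "vec ?m (\<lambda>i. a + b * f (?s i)) = 0\<^sub>v ?m" by (simp only: comb)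
    then have "\<forall>i<?m. a + b * f (?s i) = 0" by (auto simp: vec_eq_iff)
    then have "(\<Sum>i<?m. (a + b * f (?s i))\<^sup>2) = 0" by simp
    then have "a\<^sup>2 * ?m + b\<^sup>2 * (\<Sum>x\<in>?V. (f x)\<^sup>2) = 0"
      using sum_sorted_list_of_set_nth[OF V, of "\<lambda>x. (a + b * f x)\<^sup>2"] sq by simp
    then show "a = 0 \<and> b = 0"
      using f2 V2 by (subst (asm) add_nonneg_eq_0_iff) auto
  next
    fix a b w assume w: "w = a \<cdot>\<^sub>v ?u + b \<cdot>\<^sub>v ?v"
    define g where "g x = a + b * f x" for x
    have w: "w = vec ?m (\<lambda>i. g (?s i))" unfolding w comb g_def ..
    have "w \<bullet> w = (\<Sum>i<?m. (g (?s i))\<^sup>2)"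
      by (simp add: w scalar_prod_def power2_eq_square atLeast0LessThan)
    also have "\<dots> = (\<Sum>x\<in>?V. (g x)\<^sup>2)" by (rule sum_sorted_list_of_set_nth[OF V])
    finally have ww: "w \<bullet> w = a\<^sup>2 * ?m + b\<^sup>2 * (\<Sum>x\<in>?V. (f x)\<^sup>2)" by (simp add: g_def sq)
    have "w \<bullet> (?L *\<^sub>v w) = (\<Sum>i<?m. \<Sum>j<?m. g (?s i) * laplacian G (?s i) (?s j) * g (?s j))"
      by (simp add: w L scalar_prod_def atLeast0LessThan sum_distrib_left mult.assoc)
    also have "\<dots> = (\<Sum>i<?m. \<Sum>y\<in>?V. g (?s i) * laplacian G (?s i) y * g y)"
      by (intro sum.cong refl sum_sorted_list_of_set_nth[OF V])
    also have "\<dots> = (\<Sum>x\<in>?V. \<Sum>y\<in>?V. g x * laplacian G x y * g y)"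
      by (rule sum_sorted_list_of_set_nth[OF V])
    also have "\<dots> = (\<Sum>e\<in>edges G. weight G e * (g (Max e) - g (Min e))\<^sup>2)"
      by (rule laplacian_quadratic_form[OF wf])
    also have "\<dots> = b\<^sup>2 * (\<Sum>e\<in>edges G. weight G e * (f (Max e) - f (Min e))\<^sup>2)"
      unfolding sum_distrib_left
      by (intro sum.cong refl) (simp add: g_def power_mult_distrib flip: right_diff_distrib)
    also have "\<dots> \<le> b\<^sup>2 * (t * (\<Sum>x\<in>?V. (f x)\<^sup>2))"
      using bound by (intro mult_left_mono) auto
    \<comment> \<open>The surplus on the right is \<open>t\<close> times the squared norm of the
      constant part, nonnegative as \<open>0 \<le> t\<close>.\<close>
    also have "\<dots> \<le> t * (w \<bullet> w)"
      unfolding ww using t by (simp add: algebra_simps)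
    finally show "w \<bullet> (?L *\<^sub>v w) \<le> t * (w \<bullet> w)" .
  qed (use V2 in auto)
qed

section \<open>The hypercube\<close>

text \<open>Vertices are natural numbers, so a 0-1 vector of length \<open>d\<close> is encoded by
  its binary expansion and an edge flips one bit.\<close>

definition hypercube :: "nat \<Rightarrow> wgraph" where
  "hypercube d = \<lparr>verts = {..<2 ^ d}, edges = {{u, flip_bit i u} | u i. u < 2 ^ d \<and> i < d},
    weight = \<lambda>_. 1\<rparr>"

lemma flip_bit_neq: "flip_bit i u \<noteq> u" for u :: nat
  using bit_flip_bit_iff[of i u i] by auto

lemma flip_bit_flip_bit [simp]: "flip_bit i (flip_bit i u) = u" for u :: nat
  by (rule bit_eqI) (auto simp: bit_flip_bit_iff)

text \<open>Being below \<open>2 ^ d\<close> means being fixed by \<open>take_bit d\<close>, which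
  commutes with flips at positions below \<open>d\<close>.\<close>

lemma flip_bit_less: "u < 2 ^ d \<Longrightarrow> i < d \<Longrightarrow> flip_bit i u < 2 ^ d" for u :: nat
  by (metis take_bit_flip_bit_eq take_bit_nat_eq_self_iff not_le)

lemma flip_bit_inj: "flip_bit i u = flip_bit j u \<Longrightarrow> i = j" for u :: nat
  using bit_flip_bit_iff[of i u i] bit_flip_bit_iff[of j u i] by auto

lemma wf_hypercube: "wf_wgraph (hypercube d)"
  by (auto simp: wf_wgraph_def hypercube_def flip_bit_less flip_bit_neq[symmetric] lessThan_empty_iff)

text \<open>Flipping is an involution, so either endpoint of an edge can serve as its base
  point.\<close>

lemma hypercube_edges_at:
  assumes "v < 2 ^ d"
  shows "{e \<in> edges (hypercube d). v \<in> e} = (\<lambda>i. {v, flip_bit i v}) ` {..<d}"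
proof safe
  fix e assume "e \<in> edges (hypercube d)" "v \<in> e"
  then obtain u i where e: "e = {u, flip_bit i u}" "i < d" by (auto simp: hypercube_def)
  then have "e = {v, flip_bit i v}" using \<open>v \<in> e\<close> by auto
  then show "e \<in> (\<lambda>i. {v, flip_bit i v}) ` {..<d}" using e by blast
qed (use assms in \<open>auto simp: hypercube_def\<close>)

lemma card_hypercube_edges_at:
  assumes "v < 2 ^ d"
  shows "card {e \<in> edges (hypercube d). v \<in> e} = d"
proof -
  have "inj_on (\<lambda>i. {v, flip_bit i v}) {..<d}"
    by (intro inj_onI) (auto simp: doubleton_eq_iff flip_bit_neq flip_bit_neq[symmetric] dest: flip_bit_inj)
  then show ?thesis unfolding hypercube_edges_at[OF assms] by (simp add: card_image)
qed

section \<open>Second eigenvalues of induced subgraphs of the hypercube\<close>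

lemma wf_induced:
  assumes "wf_wgraph G" "S \<subseteq> verts G" "S \<noteq> {}"
  shows "wf_wgraph (induced G S)"
  using assms by (auto simp: wf_wgraph_def induced_def intro: finite_subset)

text \<open>The test vector takes one value on either side of the cut and is orthogonal to the constants.\<close>

lemma lambda2_induced_hypercube_le:
  assumes S: "S \<subseteq> verts (hypercube d)" "2 \<le> card S"
  shows "lambda2 (lap_mat (induced (hypercube d) S)) \<le> 2"
proof -
  let ?G = "induced (hypercube d) S"
  have fin: "finite S" using S by (auto intro: card_ge_0_finite)
  obtain a b where ab: "a \<in> S" "b \<in> S" "a \<noteq> b"
    using S(2) by (metis card_le_Suc0_iff_eq fin not_less_eq_eq numeral_2_eq_2)
  \<comment> \<open>Distinct vertices differ in some bit; this coordinate cuts \<open>S\<close> into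
    two nonempty sides.\<close>
  then obtain i where i: "bit a i \<noteq> bit b i" using bit_eq_iff by blast
  define S1 where "S1 = {x \<in> S. bit x i}"
  define S0 where "S0 = {x \<in> S. \<not> bit x i}"
  define p where "p = real (card S1)"
  define q where "q = real (card S0)"
  have fin01: "finite S1" "finite S0" using fin by (auto simp: S1_def S0_def)
  have Sun: "S = S1 \<union> S0" "S1 \<inter> S0 = {}" by (auto simp: S1_def S0_def)
  have "S1 \<noteq> {}" "S0 \<noteq> {}" using ab i by (auto simp: S1_def S0_def)
  then have pq: "p > 0" "q > 0" using fin01 by (auto simp: p_def q_def card_gt_0_iff)
  define f where "f x = (if bit x i then q else - p)" for x :: nat
  \<comment> \<open>With \<open>h\<close> the identity the right side is
    \<open>p * q - q * p = 0\<close>; with \<open>h\<close> the square it is the squared norm of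
    \<open>f\<close>.\<close>
  have sumS: "(\<Sum>x\<in>S. h (f x)) = p * h q + q * h (- p)" for h :: "real \<Rightarrow> real"
  proof -
    have "(\<Sum>x\<in>S. h (f x)) = (\<Sum>x\<in>S1. h (f x)) + (\<Sum>x\<in>S0. h (f x))"
      unfolding Sun(1) using fin01 Sun(2) by (rule sum.union_disjoint)
    also have "(\<Sum>x\<in>S1. h (f x)) = (\<Sum>x\<in>S1. h q)" by (intro sum.cong) (auto simp: S1_def f_def)
    also have "(\<Sum>x\<in>S0. h (f x)) = (\<Sum>x\<in>S0. h (- p))" by (intro sum.cong) (auto simp: S0_def f_def)
    finally show ?thesis by (simp add: p_def q_def)
  qed
  define K where "K = {e \<in> edges ?G. f (Max e) \<noteq> f (Min e)}"
  have finE: "finite (edges ?G)"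
    by (rule finite_subset[of _ "Pow S"]) (use fin in \<open>auto simp: induced_def\<close>)
  \<comment> \<open>The value of \<open>f\<close> depends on bit \<open>i\<close> alone, so an edge
    along which it changes flips that bit.\<close>
  have K: "\<exists>x. x \<in> S \<and> flip_bit i x \<in> S \<and> e = {x, flip_bit i x}" if e: "e \<in> K" for e
  proof -
    obtain x j where xj: "e = {x, flip_bit j x}" "e \<subseteq> S" and ne: "f (Max e) \<noteq> f (Min e)"
    proof -
      have "e \<in> edges (hypercube d)" "e \<subseteq> S" "f (Max e) \<noteq> f (Min e)"
        using e by (simp_all add: K_def induced_def)
      moreover from this obtain x j where "e = {x, flip_bit j x}" by (auto simp: hypercube_def)
      ultimately show thesis by (intro that)
    qed
    have "Max e \<in> e" "Min e \<in> e" using xj Max_in[of e] Min_in[of e] by auto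
    then have "bit x i \<noteq> bit (flip_bit j x) i"
      using ne xj by (auto simp: f_def split: if_splits)
    then have "j = i" by (auto simp: bit_flip_bit_iff)
    then show ?thesis using xj by auto
  qed
  \<comment> \<open>A cut edge has an endpoint on each side, and either endpoint determines it. So
    the cut has at most \<open>min p q\<close> edges.\<close>
  have "K \<subseteq> (\<lambda>x. {x, flip_bit i x}) ` S1" "K \<subseteq> (\<lambda>x. {x, flip_bit i x}) ` S0"
  proof safe
    fix e assume "e \<in> K"
    then obtain x where x: "x \<in> S" "flip_bit i x \<in> S" "e = {x, flip_bit i x}" using K by blast
    have sides: "e = {flip_bit i x, flip_bit i (flip_bit i x)}"
      using x by (simp add: insert_commute)
    have split: "x \<in> S1 \<and> flip_bit i x \<in> S0 \<or> x \<in> S0 \<and> flip_bit i x \<in> S1"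
      using x by (auto simp: S1_def S0_def bit_flip_bit_iff)
    show "e \<in> (\<lambda>x. {x, flip_bit i x}) ` S1"
      using x(3) sides split by blast
    show "e \<in> (\<lambda>x. {x, flip_bit i x}) ` S0"
      using x(3) sides split by blast
  qed
  then have "card K \<le> card S1" "card K \<le> card S0"
    using surj_card_le fin01 by blast+
  then have Kle: "real (card K) \<le> p" "real (card K) \<le> q" by (auto simp: p_def q_def)
  have "(\<Sum>e\<in>edges ?G. weight ?G e * (f (Max e) - f (Min e))\<^sup>2) =
    (\<Sum>e\<in>K. weight ?G e * (f (Max e) - f (Min e))\<^sup>2)"
    using finE by (intro sum.mono_neutral_right) (auto simp: K_def)
  also have "\<dots> = (\<Sum>e\<in>K. (p + q)\<^sup>2)"
  proof (intro sum.cong refl)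
    fix e assume "e \<in> K"
    then have "f (Max e) \<noteq> f (Min e)" by (simp add: K_def)
    then show "weight ?G e * (f (Max e) - f (Min e))\<^sup>2 = (p + q)\<^sup>2"
      by (auto simp: f_def induced_def hypercube_def power2_eq_square algebra_simps split: if_splits)
  qed
  also have "\<dots> = (real (card K) * p + real (card K) * q) * (p + q)"
    by (simp add: power2_eq_square algebra_simps)
  \<comment> \<open>The two bounds on \<open>card K\<close> are used crosswise, giving
    \<open>2 * p * q * (p + q)\<close>, which is twice the squared norm of \<open>f\<close>.\<close>
  also have "\<dots> \<le> (q * p + p * q) * (p + q)"
    using Kle pq by (intro mult_right_mono add_mono) auto
  also have "\<dots> = 2 * (p * q\<^sup>2 + q * (- p)\<^sup>2)"
    by (simp add: power2_eq_square algebra_simps)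
  also have "\<dots> = 2 * (\<Sum>x\<in>S. (f x)\<^sup>2)"
    using sumS[of "\<lambda>y. y\<^sup>2"] by simp
  finally have bound: "(\<Sum>e\<in>edges ?G. weight ?G e * (f (Max e) - f (Min e))\<^sup>2) \<le>
    2 * (\<Sum>x\<in>S. (f x)\<^sup>2)" .
  have vG: "verts ?G = S" by (simp add: induced_def)
  show ?thesis
  proof (rule lambda2_lap_mat_le[where f = f])
    show "wf_wgraph ?G" using S ab by (intro wf_induced wf_hypercube) auto
    show "(\<Sum>x\<in>verts ?G. f x) = 0" using sumS[of "\<lambda>y. y"] by (simp add: vG)
    show "\<exists>x\<in>verts ?G. f x \<noteq> 0" using ab pq by (intro bexI[of _ a]) (auto simp: vG f_def)
  qed (use bound S in \<open>auto simp: vG\<close>)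
qed

lemma lambda_ind_hypercube_le:
  assumes "0 < d" "\<delta> \<le> 1"
  shows "lambda_ind (hypercube d) \<delta> \<le> 2"
proof -
  let ?V = "verts (hypercube d)"
  let ?X = "{S. S \<subseteq> ?V \<and> real (card S) \<ge> \<delta> * real (card ?V) \<and> card S \<ge> 2}"
  let ?l = "\<lambda>S. lambda2 (lap_mat (induced (hypercube d) S))"
  have V: "finite ?V" "card ?V = 2 ^ d" by (auto simp: hypercube_def)
  have "(2::nat) ^ 1 \<le> 2 ^ d" using assms by (intro power_increasing) auto
  \<comment> \<open>The full vertex set is admissible, as \<open>\<delta> \<le> 1\<close> and
    \<open>0 < d\<close>. Hence \<open>Max\<close> ranges over a nonempty set.\<close>
  then have "?V \<in> ?X" using V assms mult_right_mono[of \<delta> 1 "2 ^ d"] by simp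
  moreover have "finite ?X" by (rule finite_subset[of _ "Pow ?V"]) (use V in \<open>auto\<close>)
  ultimately have "Max (?l ` ?X) \<le> 2"
    by (subst Max_le_iff) (auto intro: lambda2_induced_hypercube_le)
  then show ?thesis by (simp add: lambda_ind_def image_Collect)
qed

section \<open>A feasible point of the program on the hypercube\<close>

text \<open>Neighbours of \<open>u\<close> correspond to edges at \<open>u\<close>, of which there
  are \<open>d\<close>. This computes the sums over \<open>y\<close> in constraints (2) and
  (3).\<close>

lemma sum_hypercube_edge_weights:
  assumes "u < 2 ^ d"
  shows "(\<Sum>v\<in>verts (hypercube d) - {u}. if {u, v} \<in> edges (hypercube d) then c else 0) = real d * c"
proof -
  let ?V = "verts (hypercube d)" and ?E = "edges (hypercube d)"
  have bij: "bij_betw (\<lambda>v. {u, v}) {v \<in> ?V - {u}. {u, v} \<in> ?E} {e \<in> ?E. u \<in> e}"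
    unfolding hypercube_edges_at[OF assms]
  proof (rule bij_betw_imageI)
    show "inj_on (\<lambda>v. {u, v}) {v \<in> ?V - {u}. {u, v} \<in> ?E}"
      by (auto simp: inj_on_def doubleton_eq_iff)
    show "(\<lambda>v. {u, v}) ` {v \<in> ?V - {u}. {u, v} \<in> ?E} = (\<lambda>i. {u, flip_bit i u}) ` {..<d}"
    proof (intro equalityI subsetI)
      fix e assume "e \<in> (\<lambda>v. {u, v}) ` {v \<in> ?V - {u}. {u, v} \<in> ?E}"
      then have "e \<in> {e \<in> ?E. u \<in> e}" by auto
      then show "e \<in> (\<lambda>i. {u, flip_bit i u}) ` {..<d}"
        unfolding hypercube_edges_at[OF assms] .
    next
      fix e assume "e \<in> (\<lambda>i. {u, flip_bit i u}) ` {..<d}"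
      then obtain i where "i < d" "e = {u, flip_bit i u}" by auto
      then show "e \<in> (\<lambda>v. {u, v}) ` {v \<in> ?V - {u}. {u, v} \<in> ?E}"
        using assms flip_bit_less[of u d i] flip_bit_neq[of i u]
        by (intro image_eqI[of _ _ "flip_bit i u"]) (auto simp: hypercube_def)
    qed
  qed
  have "card {v \<in> ?V - {u}. {u, v} \<in> ?E} = d"
    using bij_betw_same_card[OF bij] card_hypercube_edges_at[OF assms] by simp
  moreover have "(\<Sum>v\<in>?V - {u}. if {u, v} \<in> ?E then c else 0) =
    (\<Sum>v\<in>{v \<in> ?V - {u}. {u, v} \<in> ?E}. c)"
    by (rule sum.inter_filter[symmetric]) (simp add: hypercube_def)
  ultimately show ?thesis by simp
qed

text \<open>With \<open>x = 1\<close> and \<open>y = 1 / d\<close> on the edges, constraint (1) is an equality for \<open>\<lambda> = d\<close>.\<close>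

lemma sdp_value_hypercube_ge:
  assumes d: "0 < d" and \<delta>: "0 \<le> \<delta>" "\<delta> * 2 ^ d \<le> 1"
  shows "sdp_value (hypercube d) \<delta> \<ge> ereal (real d)"
proof -
  let ?G = "hypercube d"
  let ?V = "verts (hypercube d)" and ?E = "edges (hypercube d)"
  define y where "y p = (if p \<in> ?E then 1 / real d else 0)" for p
  have V: "finite ?V" "card ?V = 2 ^ d" "\<And>u. u \<in> ?V \<longleftrightarrow> u < 2 ^ d" by (auto simp: hypercube_def)
  have deg: "(\<Sum>v\<in>?V - {u}. y {u, v}) = 1" if "u \<in> ?V" for u
    using sum_hypercube_edge_weights[of u d "1 / real d"] that d V by (simp add: y_def)
  have E: "?E \<subseteq> vpairs ?V" using wf_hypercube[of d] by (auto simp: wf_wgraph_def vpairs_def)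
  have finp: "finite (vpairs ?V)"
    by (rule finite_subset[of _ "Pow ?V"]) (use V in \<open>auto simp: vpairs_def\<close>)
  have "(\<Sum>e\<in>?E. 1 * edge_lap ?G e a b) - real d * (\<Sum>p\<in>vpairs ?V. y p * set_lap p a b) = 0" for a b
  proof -
    have "(\<Sum>p\<in>vpairs ?V. y p * set_lap p a b) = (\<Sum>p\<in>?E. y p * set_lap p a b)"
      using E finp by (intro sum.mono_neutral_right) (auto simp: y_def)
    also have "\<dots> = (\<Sum>p\<in>?E. (1 / real d) * set_lap p a b)"
      by (intro sum.cong) (auto simp: y_def)
    finally show ?thesis
      using d by (simp add: edge_lap_def hypercube_def flip: sum_divide_distrib)
  qed
  then have "psd_on ?V (\<lambda>a b. (\<Sum>e\<in>?E. 1 * edge_lap ?G e a b)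
      - real d * (\<Sum>p\<in>vpairs ?V. y p * set_lap p a b))"
    unfolding psd_on_def by simp
  \<comment> \<open>This is constraint (3), since the sum of \<open>y\<close> at each vertex is
    1.\<close>
  moreover have "\<delta> * real (card ?V) * y p \<le> 1" for p
  proof -
    have "y p \<le> 1" "0 \<le> y p" using d by (auto simp: y_def)
    then show ?thesis using \<delta> V mult_mono[of "\<delta> * 2 ^ d" 1 "y p" 1] by simp
  qed
  \<comment> \<open>An edge exists because \<open>0 < d\<close>, so the constant
    \<open>x = 1\<close> is not the zero vector on the edges.\<close>
  moreover have "{0, flip_bit 0 0} \<in> ?E" using d by (force simp: hypercube_def)
  moreover have "0 \<le> y p" for p by (simp add: y_def)
  ultimately have "sdp_feasible ?G \<delta> (real d) (\<lambda>_. 1) y"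
    unfolding sdp_feasible_def using deg by auto
  then show ?thesis unfolding sdp_value_def by (intro Sup_upper) blast
qed

theorem theorem5p1:
  shows "\<exists>C c :: real. C > 0 \<and> c > 0 \<and>
    (\<forall>(\<Delta>::nat) (\<delta>::real). \<Delta> > 0 \<longrightarrow> \<delta> = 2 powr (- real \<Delta>) \<longrightarrow>
      (\<exists>G. wf_wgraph G \<and> unweighted G \<and> regular G (real \<Delta>) \<and>
           lambda_ind G \<delta> \<le> C \<and>
           sdp_value G \<delta> \<ge> ereal (c * real \<Delta>)))"
proof (rule exI[of _ 2], rule exI[of _ 1], intro conjI allI impI)
  \<comment> \<open>The constant 2 bounds the second eigenvalue of every induced subgraph with at
    least two vertices; the constant 1 works because the program attains \<open>d\<close>
    itself.\<close>
  fix d :: nat and \<delta> :: real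
  assume d: "0 < d" and \<delta>: "\<delta> = 2 powr (- real d)"
  have \<delta>': "0 \<le> \<delta>" "\<delta> \<le> 1" "\<delta> * 2 ^ d = 1"
    by (auto simp: \<delta> powr_minus powr_realpow field_simps)
  have "unweighted (hypercube d)" by (simp add: unweighted_def hypercube_def)
  moreover have "regular (hypercube d) (real d)"
    unfolding regular_def
  proof
    fix v assume "v \<in> verts (hypercube d)"
    then show "(\<Sum>e | e \<in> edges (hypercube d) \<and> v \<in> e. weight (hypercube d) e) = real d"
      using card_hypercube_edges_at[of v d] by (simp add: hypercube_def)
  qed
  ultimately show "\<exists>G. wf_wgraph G \<and> unweighted G \<and> regular G (real d) \<and>
    lambda_ind G \<delta> \<le> 2 \<and> sdp_value G \<delta> \<ge> ereal (1 * real d)"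
    using wf_hypercube lambda_ind_hypercube_le[OF d \<delta>'(2)] sdp_value_hypercube_ge[OF d \<delta>'(1)] \<delta>'(3)
    by (intro exI[of _ "hypercube d"]) simp
qed auto

end
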